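(* For all integers $k,a\ge 1$, the following identities hold in $\mathbf{U}^\imath$: $$B_{\bar 0}^{(2k-1)}B_{\bar 0}^{(2a-1)}=\begin{bmatrix}2k+2a-2\\2k-1\end{bmatrix}\Big(B_{\bar 0}^{(2k+2a-2)}+\sum_{\ell=2}^{k}\prod_{m=2}^{\ell}\frac{[2a-2m+2][2k-2m+2]}{[2k+2a-2m+1][2m-2]}(q\varsigma)^{\ell-1}B_{\bar 0}^{(2k+2a-2\ell)}\Big),$$ $$B_{\bar 0}^{(2k-1)}B_{\bar 0}^{(2a)}=\begin{bmatrix}2k+2a-1\\2k-1\end{bmatrix}\Big(B_{\bar 0}^{(2k+2a-1)}+\sum_{\ell=1}^{k}\prod_{m=1}^{\ell}\frac{[2a-2m+2][2k-2m+2]}{[2k+2a-2m+1][2m]}(q\varsigma)^{\ell}B_{\bar 0}^{(2k+2a-2\ell-1)}\Big),$$ $$B_{\bar 0}^{(2k)}B_{\bar 0}^{(2a-1)}=\begin{bmatrix}2k+2a-1\\2k\end{bmatrix}\Big(B_{\bar 0}^{(2k+2a-1)}+\sum_{\ell=1}^{k}\prod_{m=1}^{\ell}\frac{[2a-2m+2][2k-2m+2]}{[2k+2a-2m+1][2m]}(q\varsigma)^{\ell}B_{\bar 0}^{(2k+2a-2\ell-1)}\Big),$$ $$B_{\bar 0}^{(2k)}B_{\bar 0}^{(2a)}=\begin{bmatrix}2k+2a\\2k\end{bmatrix}\Big(B_{\bar 0}^{(2k+2a)}+\sum_{\ell=1}^{k}\frac{[2k+2a-2\ell]}{[2k+2a]}\prod_{m=1}^{\ell}\frac{[2a-2m+2][2k-2m+2]}{[2k+2a-2m+1][2m]}(q\varsigma)^{\ell}B_{\bar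 0}^{(2k+2a-2\ell)}\Big).$$
   Context: The base field is $\mathbb{Q}(q)$, $q$ an indeterminate, and $\varsigma\in\mathbb{Q}(q)^\times$ is a fixed parameter. Quantum integers: $[n]=\frac{q^n-q^{-n}}{q-q^{-1}}$ for $n\in\mathbb{Z}$, $[n]!=[1][2]\cdots[n]$ (with $[0]!=1$), and $\begin{bmatrix}n\\k\end{bmatrix}=\frac{[n]!}{[k]!\,[n-k]!}$ for $0\le k\le n$. Let $\mathbf{U}$ be the quantum group of $\mathfrak{sl}_2$ over $\mathbb{Q}(q)$ with generators $E,F,K^{\pm1}$ and relations $KE=q^2EK$, $KF=q^{-2}FK$, $EF-FE=\frac{K-K^{-1}}{q-q^{-1}}$. Let $B=F+\varsigma EK^{-1}\in\mathbf{U}$, and let $\mathbf{U}^\imath=\mathbb{Q}(q)[B]$ be the subalgebra of $\mathbf{U}$ generated by $B$, which is a polynomial algebra in $B$. The $\imath$-divided powers of parity $\bar 0$ are defined for $n\in\mathbb{N}=\{0,1,2,\dots\}$ by $$B_{\bar 0}^{(n)}=\frac{1}{[n]!}\begin{cases}B\prod_{j=1}^{k}(B^2-q\varsigma[2j]^2)& n=2k+1,\\ \prod_{j=1}^{k}(B^2-q\varsigma[2j-2]^2)& n=2k.\end{cases}$$ Empty sums are $0$ and empty products are $1$. *)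

theory Defs
  imports "HOL-Library.Poly_Mapping" "HOL-Computational_Algebra.Computational_Algebra"
begin

type_synonym qfield = "rat poly fract"

definition qvar :: qfield where
  "qvar = Fraction_Field.Fract [:0, 1:] 1"

definition qint :: "int \<Rightarrow> qfield" where
  "qint n = (qvar powi n - qvar powi (- n)) / (qvar - inverse qvar)"

definition qfact :: "nat \<Rightarrow> qfield" where
  "qfact n = (\<Prod>i=1..n. qint (int i))"

text \<open>Meaningful only for \<open>k \<le> n\<close>, since \<open>n - k\<close> is truncated.\<close>

definition qbinom :: "nat \<Rightarrow> nat \<Rightarrow> qfield" where
  "qbinom n k = qfact n / (qfact k * qfact (n - k))"

datatype gen = gE | gF | gK | gKinv

text \<open>Words form the free monoid, written additively so that \<open>word \<Rightarrow>\<^sub>0 qfield\<close>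
  with the convolution product is the free associative unital algebra.\<close>

datatype word = Word "gen list"

instantiation word :: monoid_add
begin

definition zero_word :: word where "0 = Word []"

fun plus_word :: "word \<Rightarrow> word \<Rightarrow> word" where
  "Word u + Word v = Word (u @ v)"

instance
proof
  fix a b c :: word
  show "a + b + c = a + (b + c)" by (cases a; cases b; cases c) simp
  show "0 + a = a" by (cases a) (simp add: zero_word_def)
  show "a + 0 = a" by (cases a) (simp add: zero_word_def)
qed

end

type_synonym free_alg = "word \<Rightarrow>\<^sub>0 qfield"

definition fgen :: "gen \<Rightarrow> free_alg" where
  "fgen g = Poly_Mapping.single (Word [g]) 1"

definition fconst :: "qfield \<Rightarrow> free_alg" where
  "fconst c = Poly_Mapping.single 0 c"

inductive_set two_sided_ideal :: "'a::ring_1 set \<Rightarrow> 'a set" for R where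
  zero: "0 \<in> two_sided_ideal R"
| gen: "r \<in> R \<Longrightarrow> x * r * y \<in> two_sided_ideal R"
| add: "x \<in> two_sided_ideal R \<Longrightarrow> y \<in> two_sided_ideal R \<Longrightarrow> x + y \<in> two_sided_ideal R"

lemma two_sided_ideal_mult_left:
  "x \<in> two_sided_ideal R \<Longrightarrow> z * x \<in> two_sided_ideal R"
proof (induction rule: two_sided_ideal.induct)
  case (gen r x y)
  then show ?case using two_sided_ideal.gen[of r R "z * x" y] by (simp add: mult.assoc)
qed (auto intro: two_sided_ideal.intros simp: distrib_left)

lemma two_sided_ideal_mult_right:
  "x \<in> two_sided_ideal R \<Longrightarrow> x * z \<in> two_sided_ideal R"
proof (induction rule: two_sided_ideal.induct)
  case (gen r x y)
  then show ?case using two_sided_ideal.gen[of r R x "y * z"] by (simp add: mult.assoc)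
qed (auto intro: two_sided_ideal.intros simp: distrib_right)

lemma two_sided_ideal_uminus: "x \<in> two_sided_ideal R \<Longrightarrow> - x \<in> two_sided_ideal R"
  using two_sided_ideal_mult_left[of x R "- 1"] by simp

definition U_relations :: "free_alg set" where
  "U_relations = {
     fgen gK * fgen gKinv - 1,
     fgen gKinv * fgen gK - 1,
     fgen gK * fgen gE - fconst (qvar ^ 2) * fgen gE * fgen gK,
     fgen gK * fgen gF - fconst (inverse (qvar ^ 2)) * fgen gF * fgen gK,
     fgen gE * fgen gF - fgen gF * fgen gE
       - fconst (inverse (qvar - inverse qvar)) * (fgen gK - fgen gKinv)}"

definition U_rel :: "free_alg \<Rightarrow> free_alg \<Rightarrow> bool" where
  "U_rel x y \<longleftrightarrow> x - y \<in> two_sided_ideal U_relations"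

lemma U_rel_equivp: "equivp U_rel"
proof (rule equivpI)
  show "reflp U_rel" by (rule reflpI) (simp add: U_rel_def two_sided_ideal.zero)
  show "symp U_rel"
  proof (rule sympI)
    fix x y assume "U_rel x y"
    then have "- (x - y) \<in> two_sided_ideal U_relations"
      unfolding U_rel_def by (rule two_sided_ideal_uminus)
    then show "U_rel y x" by (simp only: U_rel_def minus_diff_eq)
  qed
  show "transp U_rel"
  proof (rule transpI)
    fix x y z assume "U_rel x y" "U_rel y z"
    then have "(x - y) + (y - z) \<in> two_sided_ideal U_relations"
      unfolding U_rel_def by (rule two_sided_ideal.add)
    then show "U_rel x z" by (simp add: U_rel_def)
  qed
qed

text \<open>The counit (with \<open>E, F \<mapsto> 0\<close> and \<open>K \<mapsto> 1\<close>) shows that the quotient is nonzero.\<close>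

fun wcounit :: "word \<Rightarrow> qfield" where
  "wcounit (Word u) = (if gE \<in> set u \<or> gF \<in> set u then 0 else 1)"

lemma wcounit_plus: "wcounit (u + v) = wcounit u * wcounit v"
  by (cases u; cases v) auto

definition counit :: "free_alg \<Rightarrow> qfield" where
  "counit p = (\<Sum>w\<in>Poly_Mapping.keys p. Poly_Mapping.lookup p w * wcounit w)"

lemma counit_superset:
  assumes "finite S" "Poly_Mapping.keys p \<subseteq> S"
  shows "counit p = (\<Sum>w\<in>S. Poly_Mapping.lookup p w * wcounit w)"
  unfolding counit_def by (rule sum.mono_neutral_left) (use assms in \<open>auto simp: in_keys_iff\<close>)

lemma counit_add: "counit (x + y) = counit x + counit y"
proof -
  let ?S = "Poly_Mapping.keys x \<union> Poly_Mapping.keys y"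
  have "counit (x + y) = (\<Sum>w\<in>?S. Poly_Mapping.lookup (x + y) w * wcounit w)"
    by (rule counit_superset) (auto simp: Poly_Mapping.keys_add)
  also have "\<dots> = (\<Sum>w\<in>?S. Poly_Mapping.lookup x w * wcounit w)
      + (\<Sum>w\<in>?S. Poly_Mapping.lookup y w * wcounit w)"
    by (simp add: lookup_add distrib_right sum.distrib)
  also have "\<dots> = counit x + counit y"
    by (simp add: counit_superset[of ?S x] counit_superset[of ?S y])
  finally show ?thesis .
qed

lemma counit_zero [simp]: "counit 0 = 0"
  by (simp add: counit_def)

lemma counit_single [simp]: "counit (Poly_Mapping.single w c) = c * wcounit w"
  by (simp add: counit_def)

lemma counit_one [simp]: "counit 1 = 1"
  using counit_single[of 0 1] by (simp add: zero_word_def flip: single_one)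

lemma counit_diff: "counit (x - y) = counit x - counit y"
  using counit_add[of "x - y" y] by simp

lemma free_alg_induct [case_names zero single add]:
  fixes p :: free_alg
  assumes "P 0" "\<And>w c. P (Poly_Mapping.single w c)" "\<And>x y. P x \<Longrightarrow> P y \<Longrightarrow> P (x + y)"
  shows "P p"
proof (induction p rule: update_induct)
  case const
  then show ?case using assms(1) by simp
next
  case (update f a b)
  have "Poly_Mapping.update a b f = f + Poly_Mapping.single a b"
    by (rule poly_mapping_eqI)
      (use update in \<open>auto simp: lookup_update lookup_add lookup_single when_def in_keys_iff\<close>)
  then show ?case using assms update by simp
qed

lemma counit_mult: "counit (x * y) = counit x * counit y"
proof (induction x rule: free_alg_induct)
  case (single w c)
  show ?case
    by (induction y rule: free_alg_induct)
      (simp_all add: counit_add distrib_left mult_single wcounit_plus)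
qed (simp_all add: counit_add distrib_right)

lemma counit_ideal: "x \<in> two_sided_ideal U_relations \<Longrightarrow> counit x = 0"
proof (induction rule: two_sided_ideal.induct)
  case (gen r x y)
  then have "counit r = 0"
    by (auto simp: U_relations_def counit_diff counit_mult fgen_def fconst_def)
  then show ?case by (simp add: counit_mult)
qed (simp_all add: counit_add)

quotient_type U = free_alg / U_rel
  by (rule U_rel_equivp)

instantiation U :: ring_1
begin

lift_definition zero_U :: U is 0 .
lift_definition one_U :: U is 1 .

lift_definition plus_U :: "U \<Rightarrow> U \<Rightarrow> U" is "(+)"
proof -
  fix x x' y y' :: free_alg
  assume "U_rel x x'" "U_rel y y'"
  then have "(x - x') + (y - y') \<in> two_sided_ideal U_relations"
    unfolding U_rel_def by (rule two_sided_ideal.add)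
  then show "U_rel (x + y) (x' + y')"
    by (simp only: U_rel_def add_diff_add)
qed

lift_definition uminus_U :: "U \<Rightarrow> U" is uminus
proof -
  fix x x' :: free_alg
  assume "U_rel x x'"
  then have "- (x - x') \<in> two_sided_ideal U_relations"
    unfolding U_rel_def by (rule two_sided_ideal_uminus)
  then show "U_rel (- x) (- x')"
    by (simp only: U_rel_def minus_diff_minus)
qed

definition minus_U :: "U \<Rightarrow> U \<Rightarrow> U" where
  "minus_U x y = x + - y"

lift_definition times_U :: "U \<Rightarrow> U \<Rightarrow> U" is "(*)"
proof -
  fix x x' y y' :: free_alg
  assume *: "U_rel x x'" "U_rel y y'"
  have "x * y - x' * y' = (x - x') * y + x' * (y - y')" by (simp add: algebra_simps)
  then show "U_rel (x * y) (x' * y')"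
    using * unfolding U_rel_def
    by (simp only: two_sided_ideal.add two_sided_ideal_mult_left two_sided_ideal_mult_right)
qed

instance
proof
  have refl: "U_rel x y" if "x = y" for x y
    using that U_rel_equivp by (auto simp: equivp_reflp)
  fix a b c :: U
  show "a + b + c = a + (b + c)" by transfer (rule refl, simp add: algebra_simps)
  show "a + b = b + a" by transfer (rule refl, simp add: algebra_simps)
  show "0 + a = a" by transfer (rule refl, simp)
  show "- a + a = 0" by transfer (rule refl, simp)
  show "a - b = a + - b" by (rule minus_U_def)
  show "a * b * c = a * (b * c)" by transfer (rule refl, simp add: algebra_simps)
  show "(a + b) * c = a * c + b * c" by transfer (rule refl, simp add: algebra_simps)
  show "a * (b + c) = a * b + a * c" by transfer (rule refl, simp add: algebra_simps)
  show "1 * a = a" by transfer (rule refl, simp)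
  show "a * 1 = a" by transfer (rule refl, simp)
  show "(0 :: U) \<noteq> 1"
  proof transfer
    show "\<not> U_rel 0 1"
    proof
      assume "U_rel 0 1"
      then have "counit (0 - 1) = 0" unfolding U_rel_def by (rule counit_ideal)
      then show False by (simp only: counit_diff) simp
    qed
  qed
qed

end

lift_definition scaleq :: "qfield \<Rightarrow> U \<Rightarrow> U" (infixr "*\<^sub>q" 75) is "\<lambda>c x. fconst c * x"
  unfolding U_rel_def by (simp only: two_sided_ideal_mult_left flip: right_diff_distrib)

lift_definition E :: U is "fgen gE" .
lift_definition F :: U is "fgen gF" .
lift_definition K :: U is "fgen gK" .
lift_definition Kinv :: U is "fgen gKinv" .

lemma fconst_commute: "fconst c * x = x * fconst c"
  by (induction x rule: free_alg_induct)
    (simp_all add: distrib_left distrib_right fconst_def mult_single mult.commute)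

lemma
  shows scaleq_add_right: "c *\<^sub>q (x + y) = c *\<^sub>q x + c *\<^sub>q y"
    and scaleq_add_left: "(c + d) *\<^sub>q x = c *\<^sub>q x + d *\<^sub>q x"
    and scaleq_scaleq: "c *\<^sub>q d *\<^sub>q x = (c * d) *\<^sub>q x"
    and scaleq_one: "1 *\<^sub>q x = x"
    and scaleq_mult_left: "(c *\<^sub>q x) * y = c *\<^sub>q (x * y)"
    and scaleq_mult_right: "x * (c *\<^sub>q y) = c *\<^sub>q (x * y)"
proof -
  have refl: "U_rel x y" if "x = y" for x y
    using that U_rel_equivp by (auto simp: equivp_reflp)
  show "c *\<^sub>q (x + y) = c *\<^sub>q x + c *\<^sub>q y"
    by transfer (rule refl, simp add: distrib_left)
  show "(c + d) *\<^sub>q x = c *\<^sub>q x + d *\<^sub>q x"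
    by transfer (rule refl, simp add: fconst_def single_add distrib_right)
  show "c *\<^sub>q d *\<^sub>q x = (c * d) *\<^sub>q x"
    by transfer (rule refl, simp add: fconst_def mult_single flip: mult.assoc)
  show "1 *\<^sub>q x = x"
    by transfer (rule refl, simp add: fconst_def)
  show "(c *\<^sub>q x) * y = c *\<^sub>q (x * y)"
    by transfer (rule refl, simp add: mult.assoc)
  show "x * (c *\<^sub>q y) = c *\<^sub>q (x * y)"
  proof (transfer, rule refl)
    fix x y :: free_alg and c
    have "x * (fconst c * y) = (x * fconst c) * y" by (rule mult.assoc[symmetric])
    also have "\<dots> = (fconst c * x) * y" by (simp only: fconst_commute[of c x])
    also have "\<dots> = fconst c * (x * y)" by (rule mult.assoc)
    finally show "x * (fconst c * y) = fconst c * (x * y)" .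
  qed
qed

lemma U_relsD: "r \<in> U_relations \<Longrightarrow> r \<in> two_sided_ideal U_relations"
  using two_sided_ideal.gen[of r U_relations 1 1] by simp

lemma
  shows K_Kinv: "K * Kinv = 1"
    and Kinv_K: "Kinv * K = 1"
    and K_E: "K * E = qvar ^ 2 *\<^sub>q (E * K)"
    and K_F: "K * F = inverse (qvar ^ 2) *\<^sub>q (F * K)"
    and E_F: "E * F - F * E = inverse (qvar - inverse qvar) *\<^sub>q (K - Kinv)"
proof -
  show "K * Kinv = 1"
    by (transfer, unfold U_rel_def, rule U_relsD, unfold U_relations_def) blast
  show "Kinv * K = 1"
    by (transfer, unfold U_rel_def, rule U_relsD, unfold U_relations_def) blast
  show "K * E = qvar ^ 2 *\<^sub>q (E * K)"
    by (transfer, unfold U_rel_def, rule U_relsD, unfold U_relations_def mult.assoc[symmetric]) blast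
  show "K * F = inverse (qvar ^ 2) *\<^sub>q (F * K)"
    by (transfer, unfold U_rel_def, rule U_relsD, unfold U_relations_def mult.assoc[symmetric]) blast
  show "E * F - F * E = inverse (qvar - inverse qvar) *\<^sub>q (K - Kinv)"
    by (unfold minus_U_def, transfer, unfold U_rel_def, rule U_relsD,
        unfold U_relations_def diff_conv_add_uminus) blast
qed

text \<open>\<open>\<sigma>\<close> is the nonzero parameter usually written as a final sigma.\<close>

definition B :: "qfield \<Rightarrow> U" where
  "B \<sigma> = F + \<sigma> *\<^sub>q (E * Kinv)"

inductive_set Ui :: "qfield \<Rightarrow> U set" for \<sigma> :: qfield where
  one: "1 \<in> Ui \<sigma>"
| gen: "B \<sigma> \<in> Ui \<sigma>"
| add: "x \<in> Ui \<sigma> \<Longrightarrow> y \<in> Ui \<sigma> \<Longrightarrow> x + y \<in> Ui \<sigma>"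
| mult: "x \<in> Ui \<sigma> \<Longrightarrow> y \<in> Ui \<sigma> \<Longrightarrow> x * y \<in> Ui \<sigma>"
| scale: "x \<in> Ui \<sigma> \<Longrightarrow> c *\<^sub>q x \<in> Ui \<sigma>"

text \<open>Here \<open>k = n div 2\<close>. The list product stands in for \<open>\<Prod>\<close>, which requires a commutative
  ring; all factors are polynomials in \<open>B \<sigma>\<close>, so their order is immaterial.\<close>

definition idp0 :: "qfield \<Rightarrow> nat \<Rightarrow> U" where
  "idp0 \<sigma> n = inverse (qfact n) *\<^sub>q
     (if odd n
      then B \<sigma> * prod_list (map (\<lambda>j. B \<sigma> ^ 2 - (qvar * \<sigma> * qint (2 * int j) ^ 2) *\<^sub>q 1)
                               [1..<n div 2 + 1])
      else prod_list (map (\<lambda>j. B \<sigma> ^ 2 - (qvar * \<sigma> * qint (2 * int j - 2) ^ 2) *\<^sub>q 1)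
                        [1..<n div 2 + 1]))"

lemma scaleq_zero: "0 *\<^sub>q x = 0"
  using scaleq_add_left[of 0 0 x] by simp

lemma Ui_diff:
  assumes "x \<in> Ui \<sigma>" "y \<in> Ui \<sigma>"
  shows "x - y \<in> Ui \<sigma>"
proof -
  have "(-1) *\<^sub>q y + y = (-1) *\<^sub>q y + 1 *\<^sub>q y"
    by (simp only: scaleq_one)
  also have "\<dots> = (-1 + 1) *\<^sub>q y"
    by (rule scaleq_add_left[symmetric])
  also have "\<dots> = 0"
    by (simp only: add.left_inverse scaleq_zero)
  finally have "(-1) *\<^sub>q y = - y"
    by (rule eq_neg_iff_add_eq_0[THEN iffD2])
  moreover have "x + (-1) *\<^sub>q y \<in> Ui \<sigma>"
    using assms by (intro Ui.add Ui.scale)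
  ultimately show ?thesis
    by (simp only: diff_conv_add_uminus)
qed

lemma Ui_prod_list: "(\<And>x. x \<in> set xs \<Longrightarrow> x \<in> Ui \<sigma>) \<Longrightarrow> prod_list xs \<in> Ui \<sigma>"
  by (induction xs) (auto intro: Ui.intros)

lemma idp0_in_Ui: "idp0 \<sigma> n \<in> Ui \<sigma>"
proof -
  have sq: "B \<sigma> ^ 2 \<in> Ui \<sigma>"
    unfolding power2_eq_square by (intro Ui.mult Ui.gen)
  have fac: "B \<sigma> ^ 2 - c *\<^sub>q 1 \<in> Ui \<sigma>" for c
    by (intro Ui_diff sq Ui.scale Ui.one)
  have prod: "prod_list (map (\<lambda>j. B \<sigma> ^ 2 - c j *\<^sub>q 1) xs) \<in> Ui \<sigma>" for c :: "nat \<Rightarrow> qfield" and xs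
    by (rule Ui_prod_list) (use fac in \<open>unfold set_map, blast\<close>)
  show ?thesis
    unfolding idp0_def
    by (rule Ui.scale, split if_split, intro conjI impI Ui.mult Ui.gen prod)
qed

end

(* With s = q \<sigma> and P(n) the product of B^2 - s [2j]^2 over 1 \<le> j \<le> n, the divided powers are
   B P(n) / [2n+1]! and B^2 P(n) / [2n+2]!. So everything reduces to expanding P(k) P(a) and
   B^2 P(k) P(a) in the basis P(n). Since [x]^2 - [y]^2 = [x-y] [x+y], multiplying P(n) by
   B^2 - s [2a+2]^2 gives P(n+1) + s [2(n-a)] [2(n+a+2)] P(n). By induction on a this yields a
   two-term recurrence for the coefficients, which the closed product formula satisfies because
   [x] [y] - [x-l] [y-l] = [l] [x+y-l]. *)
theory Submission
  imports Defs
begin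

section \<open>Quantum integers and factorials in the field of rational functions\<close>

lemma qvar_power: "qvar ^ n = Fraction_Field.Fract (monom 1 n) 1"
  by (induction n) (auto simp: qvar_def One_fract_def monom_Suc)

lemma qvar_nonzero [simp]: "qvar \<noteq> 0"
  by (simp add: qvar_def eq_fract Zero_fract_def)

lemma qvar_power_neq_1: "n > 0 \<Longrightarrow> qvar ^ n \<noteq> 1"
  unfolding qvar_power by (simp add: One_fract_def eq_fract monom_eq_1_iff)

text \<open>Equality would give q^(2n) = q^n q^(-n) = 1, but q is not a root of unity. This makes
  the numerator of [n] nonzero, and for n = 1 also the common denominator.\<close>

lemma qvar_powi_neq_uminus:
  assumes "n > 0"
  shows "qvar powi n \<noteq> qvar powi (- n)"
proof
  assume eq: "qvar powi n = qvar powi (- n)"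
  have "qvar ^ (2 * nat n) = qvar powi n * qvar powi n"
    using assms by (simp add: power_int_def flip: power_add mult_2)
  also have "\<dots> = qvar powi n * qvar powi (- n)"
    using eq by simp
  also have "\<dots> = 1"
    by (simp flip: power_int_add)
  finally show False
    using qvar_power_neq_1[of "2 * nat n"] assms by simp
qed

lemma qvar_diff_inverse: "qvar - inverse qvar \<noteq> 0"
  using qvar_powi_neq_uminus[of 1] by simp

lemma qint_pos_nonzero: "n > 0 \<Longrightarrow> qint n \<noteq> 0"
  using qvar_powi_neq_uminus[of n] qvar_diff_inverse by (simp add: qint_def)

lemma qint_0 [simp]: "qint 0 = 0"
  by (simp add: qint_def)

text \<open>After clearing denominators, the mixed terms q^(x-y) and q^(y-x) of the two products on
  the left cancel, and the remainder factors. Both the difference of squares and the coefficient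
  recurrence are instances.\<close>

lemma qint_mult_diff: "qint x * qint y - qint (x - l) * qint (y - l) = qint l * qint (x + y - l)"
proof -
  define X Y L d where XYL: "X = qvar powi x" "Y = qvar powi y" "L = qvar powi l"
    and d: "d = qvar - inverse qvar"
  have "X \<noteq> 0" "Y \<noteq> 0" "L \<noteq> 0" "d \<noteq> 0"
    using qvar_diff_inverse by (simp_all add: XYL d)
  then show ?thesis
    by (simp add: qint_def power_int_add power_int_diff power_int_minus flip: XYL d)
      (simp add: field_simps)
qed

lemma qfact_Suc: "qfact (Suc n) = qfact n * qint (int (Suc n))"
  by (simp add: qfact_def)

lemma qfact_nonzero [simp]: "qfact n \<noteq> 0"
  by (induction n) (simp add: qfact_def, simp add: qfact_Suc qint_pos_nonzero)

text \<open>Peels the top 2l factors off [n]! in neighbouring pairs. Each pair has one even and one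
  odd argument, so one of them can cancel a denominator while the other stays.\<close>

lemma qfact_split:
  assumes "2 * l \<le> n"
  shows "qfact n = qfact (n - 2 * l) *
    (\<Prod>m=1..l. qint (int n - 2 * int m + 2) * qint (int n - 2 * int m + 1))"
  using assms
proof (induction l)
  case (Suc l)
  \<comment> \<open>With \<open>r\<close> in place of n - 2(l+1), no truncated subtraction is left
    to reason about.\<close>
  then obtain r where n: "n = r + 2 * l + 2"
    by (metis add.commute add_2_eq_Suc' le_Suc_ex mult_Suc_right add.assoc)
  have "qfact (n - 2 * l) = qfact r * qint (int r + 1) * qint (int r + 2)"
    by (simp add: n qfact_Suc algebra_simps)
  with Suc show ?case
    by (simp add: n algebra_simps)
qed simp

section \<open>Divided powers as multiples of B P(n) and B^2 P(n)\<close>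

interpretation U: module scaleq
  by unfold_locales (simp_all add: scaleq_add_right scaleq_add_left scaleq_scaleq scaleq_one)

text \<open>This is P(n). The factors start at j = 1, so that the factor B^2 of the even divided
  powers stays separate and both parities share the same products.\<close>

definition Bprod :: "qfield \<Rightarrow> nat \<Rightarrow> U" where
  "Bprod \<sigma> n = prod_list (map (\<lambda>j. B \<sigma> ^ 2 - (qvar * \<sigma> * qint (2 * int j) ^ 2) *\<^sub>q 1) [1..<n+1])"

lemma Bprod_0 [simp]: "Bprod \<sigma> 0 = 1"
  by (simp add: Bprod_def)

lemma Bprod_Suc:
  "Bprod \<sigma> (Suc n) = Bprod \<sigma> n * (B \<sigma> ^ 2 - (qvar * \<sigma> * qint (2 * int (Suc n)) ^ 2) *\<^sub>q 1)"
  by (simp add: Bprod_def)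

text \<open>\<open>U\<close> is not commutative, so moving B past P(n) needs an argument: each
  factor is a polynomial in B.\<close>

lemma B_Bprod_commute: "Bprod \<sigma> n * B \<sigma> = B \<sigma> * Bprod \<sigma> n"
proof (induction n)
  case (Suc n)
  have "(B \<sigma> ^ 2 - c *\<^sub>q 1) * B \<sigma> = B \<sigma> * (B \<sigma> ^ 2 - c *\<^sub>q 1)" for c
    by (simp add: left_diff_distrib right_diff_distrib scaleq_mult_left scaleq_mult_right
        power2_eq_square mult.assoc)
  then show ?case
    using Suc by (metis Bprod_Suc mult.assoc)
qed simp

lemma idp0_odd: "idp0 \<sigma> (2 * n + 1) = inverse (qfact (2 * n + 1)) *\<^sub>q (B \<sigma> * Bprod \<sigma> n)"
  by (simp add: idp0_def Bprod_def)

text \<open>The factor j = 1 contains [0] = 0 and is just B^2; the factors j = 2, ..., n+1 are those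
  of P(n) shifted by one.\<close>

lemma idp0_even: "idp0 \<sigma> (2 * n + 2) = inverse (qfact (2 * n + 2)) *\<^sub>q (B \<sigma> ^ 2 * Bprod \<sigma> n)"
proof -
  have "prod_list (map (\<lambda>j. B \<sigma> ^ 2 - (qvar * \<sigma> * qint (2 * int j - 2) ^ 2) *\<^sub>q 1) [1..<Suc n + 1]) =
      B \<sigma> ^ 2 * Bprod \<sigma> n"
  proof (induction n)
    case (Suc n)
    have "[1..<Suc (Suc n) + 1] = [1..<Suc n + 1] @ [Suc (Suc n)]"
      "2 * int (Suc (Suc n)) - 2 = 2 * int (Suc n)"
      by simp_all
    then show ?case
      using Suc by (simp only: map_append prod_list.append Bprod_Suc list.map prod_list.Cons
        prod_list.Nil mult_1_right mult.assoc)
  qed simp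
  then show ?thesis
    by (simp add: idp0_def)
qed

section \<open>Expansion of P(k) P(a) and B^2 P(k) P(a) in the basis P(n)\<close>

lemma Bprod_mult_factor:
  "Bprod \<sigma> n * (B \<sigma> ^ 2 - (qvar * \<sigma> * qint (2 * i) ^ 2) *\<^sub>q 1) =
    Bprod \<sigma> (Suc n) +
    (qvar * \<sigma> * qint (2 * (int (Suc n) - i)) * qint (2 * (int (Suc n) + i))) *\<^sub>q Bprod \<sigma> n"
proof -
  let ?s = "qvar * \<sigma>" and ?N = "int (Suc n)"
  \<comment> \<open>The difference of squares, obtained from \<open>qint_mult_diff\<close> with x =
    y = 2N and l = 2N - 2i.\<close>
  have "qint (2 * (?N - i)) * qint (2 * (?N + i)) = qint (2 * ?N) ^ 2 - qint (2 * i) ^ 2"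
    using qint_mult_diff[of "2 * ?N" "2 * ?N" "2 * ?N - 2 * i"]
    by (simp add: power2_eq_square algebra_simps)
  then have *: "?s * qint (2 * (?N - i)) * qint (2 * (?N + i)) =
      ?s * qint (2 * ?N) ^ 2 - ?s * qint (2 * i) ^ 2"
    by (simp only: mult.assoc right_diff_distrib)
  show ?thesis
    unfolding * Bprod_Suc
    by (simp add: right_diff_distrib scaleq_mult_right U.scale_left_diff_distrib del: of_nat_Suc)
qed

text \<open>Induction on a: multiplying P(k+a-l) by the factor of index a+1 gives P(k+a+1-l), which
  keeps the index l, and a multiple of P(k+a-l), which moves to l+1. The left factor
  \<open>Y\<close> is kept general to cover both P(k) and B^2 P(k).\<close>

lemma mult_Bprod_expansion:
  fixes D :: "nat \<Rightarrow> nat \<Rightarrow> qfield"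
  assumes base: "Y = (\<Sum>l\<le>k. D 0 l *\<^sub>q Bprod \<sigma> (k - l))"
    and D_0: "\<And>a. D (Suc a) 0 = D a 0"
    and D_Suc: "\<And>a l. D (Suc a) (Suc l) = D a (Suc l) +
      qvar * \<sigma> * qint (2 * (int k - int l)) * qint (2 * (int k + 2 * int a + 2 - int l)) * D a l"
  shows "Y * Bprod \<sigma> a = (\<Sum>l\<le>k. D a l *\<^sub>q Bprod \<sigma> (k + a - l))"
proof (induction a)
  case 0
  then show ?case using base by simp
next
  case (Suc a)
  let ?P = "Bprod \<sigma>"
  define g where
    "g l = qvar * \<sigma> * qint (2 * (int k - int l)) * qint (2 * (int k + 2 * int a + 2 - int l))" for l
  \<comment> \<open>For l \<le> k the truncated k+a-l is exact, and n = k+a-l, i = a+1 turn n+1-i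
    and n+1+i into k-l and k+2a+2-l.\<close>
  have step: "?P (k + a - l) * (B \<sigma> ^ 2 - (qvar * \<sigma> * qint (2 * int (Suc a)) ^ 2) *\<^sub>q 1) =
      ?P (k + Suc a - l) + g l *\<^sub>q ?P (k + a - l)" if "l \<le> k" for l
  proof -
    have "int (Suc (k + a - l)) - int (Suc a) = int k - int l"
      "int (Suc (k + a - l)) + int (Suc a) = int k + 2 * int a + 2 - int l"
      "Suc (k + a - l) = k + Suc a - l"
      using that by (auto simp: of_nat_diff)
    then show ?thesis
      unfolding g_def using Bprod_mult_factor[of \<sigma> "k + a - l" "int (Suc a)"] by metis
  qed
  have "Y * ?P (Suc a) = (\<Sum>l\<le>k. D a l *\<^sub>q (?P (k + Suc a - l) + g l *\<^sub>q ?P (k + a - l)))"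
    unfolding Bprod_Suc mult.assoc[symmetric] Suc.IH sum_distrib_right scaleq_mult_left
    by (intro sum.cong refl) (simp only: step atMost_iff)
  also have "\<dots> = (\<Sum>l\<le>k. D a l *\<^sub>q ?P (k + Suc a - l)) + (\<Sum>l\<le>k. (g l * D a l) *\<^sub>q ?P (k + a - l))"
    by (simp add: U.scale_right_distrib sum.distrib mult.commute)
  \<comment> \<open>The term l = k drops out because \<open>g k\<close> contains [0], so shifting l
    to l+1 stays within the range.\<close>
  also have "(\<Sum>l\<le>k. (g l * D a l) *\<^sub>q ?P (k + a - l)) = (\<Sum>l<k. (g l * D a l) *\<^sub>q ?P (k + a - l))"
    by (simp add: g_def flip: lessThan_Suc_atMost)
  also have "(\<Sum>l\<le>k. D a l *\<^sub>q ?P (k + Suc a - l)) + \<dots> = (\<Sum>l\<le>k. D (Suc a) l *\<^sub>q ?P (k + Suc a - l))"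
    unfolding sum.atMost_shift D_0 D_Suc g_def
    by (simp add: U.scale_left_distrib sum.distrib)
  finally show ?case .
qed

text \<open>The shift \<open>e\<close> is \<open>2\<close> in the expansion of \<open>P(k) P(a)\<close> and \<open>0\<close> in that of
  \<open>B\<^sup>2 P(k - 1) P(a - 1)\<close>.\<close>

definition lin_coeff :: "int \<Rightarrow> int \<Rightarrow> int \<Rightarrow> nat \<Rightarrow> qfield" where
  "lin_coeff e k a l = (\<Prod>m=1..l. qint (2 * (a - int m + 1)) * qint (2 * (k - int m + 1)) *
     qint (2 * (k + a + e - int m)) / qint (2 * int m))"

lemma lin_coeff_0 [simp]: "lin_coeff e k a 0 = 1"
  by (simp add: lin_coeff_def)

text \<open>The factor m = a+1 contains [0]. This cuts off the sums in the two base cases, where the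
  third argument is 0 or 1.\<close>

lemma lin_coeff_eq_0:
  assumes "a < l"
  shows "lin_coeff e k (int a) l = 0"
  unfolding lin_coeff_def
  by (rule prod_zero) (use assms in \<open>auto intro!: bexI[of _ "Suc a"]\<close>)

text \<open>All three coefficients share the factors of \<open>lin_coeff e k a l\<close>; after
  dividing these out, the claim is one instance of \<open>qint_mult_diff\<close>.\<close>

lemma lin_coeff_Suc_right:
  "lin_coeff e k (a + 1) (Suc l) = lin_coeff e k a (Suc l) +
     qint (2 * (k - int l)) * qint (2 * (k + 2 * a + e - int l)) * lin_coeff e k a l"
proof -
  let ?v = "\<lambda>i. qint (2 * i)"
  let ?L = "int (Suc l)"
  \<comment> \<open>The numerator of the coefficient is a product of three such falling products,
    with b = a+1, k+1 and k+a+e. \<open>T_Suc\<close> splits off the last factor,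
    \<open>T_shift\<close> the first.\<close>
  define T where "T = (\<lambda>n b. \<Prod>m=1..n. ?v (b - int m))"
  have T_Suc: "T (Suc n) b = T n b * ?v (b - int (Suc n))" for n b
    by (simp add: T_def)
  have T_shift: "T (Suc n) (b + 1) = ?v b * T n b" for n b
    by (induction n) (simp_all add: T_def algebra_simps)
  have split: "lin_coeff e k b n = T n (b + 1) * T n (k + 1) * T n (k + b + e) / (\<Prod>m=1..n. ?v (int m))"
    for b n
    by (simp add: lin_coeff_def T_def prod.distrib prod_dividef algebra_simps)
  have nz: "?v ?L \<noteq> 0"
    by (rule qint_pos_nonzero) simp
  have key: "?v (a + 1) * ?v (k + a + e) =
      ?v (a + 1 - ?L) * ?v (k + a + e - ?L) + ?v ?L * ?v (k + 2 * a + e - int l)"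
    using qint_mult_diff[of "2 * (a + 1)" "2 * (k + a + e)" "2 * ?L"]
    by (simp add: algebra_simps)
  define R where "R = T l (a + 1) * T l (k + 1) * T l (k + a + e) / (\<Prod>m=1..l. ?v (int m))"
  \<comment> \<open>Raising a by one raises two of the falling products, which therefore lose their
    first factor; the one in k loses its last. What remains is \<open>R\<close>.\<close>
  have "lin_coeff e k (a + 1) (Suc l) =
      R * (?v (a + 1) * ?v (k + a + e)) * ?v (k + 1 - ?L) / ?v ?L"
  proof -
    have "k + (a + 1) + e = k + a + e + 1"
      by simp
    then show ?thesis
      unfolding split R_def
      by (simp only: T_shift[of l "a + 1"] T_shift[of l "k + a + e"] T_Suc[of l "k + 1"])
        (simp add: mult_ac del: of_nat_Suc)
  qed
  also have "\<dots> = R * (?v (a + 1 - ?L) * ?v (k + a + e - ?L)) * ?v (k + 1 - ?L) / ?v ?L +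
      ?v (k + 1 - ?L) * ?v (k + 2 * a + e - int l) * R"
    unfolding key using nz by (simp add: field_simps del: of_nat_Suc)
  also have "R * (?v (a + 1 - ?L) * ?v (k + a + e - ?L)) * ?v (k + 1 - ?L) / ?v ?L = lin_coeff e k a (Suc l)"
    unfolding split R_def T_Suc by (simp add: mult_ac del: of_nat_Suc)
  also have "R = lin_coeff e k a l"
    unfolding split R_def ..
  finally show ?thesis by simp
qed

lemma Bprod_mult_Bprod:
  "Bprod \<sigma> k * Bprod \<sigma> a =
    (\<Sum>l\<le>k. ((qvar * \<sigma>) ^ l * lin_coeff 2 (int k) (int a) l) *\<^sub>q Bprod \<sigma> (k + a - l))"
proof (rule mult_Bprod_expansion)
  show "Bprod \<sigma> k =
      (\<Sum>l\<le>k. ((qvar * \<sigma>) ^ l * lin_coeff 2 (int k) (int 0) l) *\<^sub>q Bprod \<sigma> (k - l))"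
    unfolding sum.atMost_shift by (simp add: lin_coeff_eq_0 del: of_nat_0)
next
  fix a l
  show "(qvar * \<sigma>) ^ Suc l * lin_coeff 2 (int k) (int (Suc a)) (Suc l) =
      (qvar * \<sigma>) ^ Suc l * lin_coeff 2 (int k) (int a) (Suc l) +
      qvar * \<sigma> * qint (2 * (int k - int l)) * qint (2 * (int k + 2 * int a + 2 - int l)) *
      ((qvar * \<sigma>) ^ l * lin_coeff 2 (int k) (int a) l)"
    using lin_coeff_Suc_right[of 2 "int k" "int a" l] by (simp add: algebra_simps)
qed simp

text \<open>The same recurrence with k+1 and a+1 as arguments: replacing a by a+1 in k+2a+e-l
  already contributes the required 2, hence the shift e = 0.\<close>

lemma B2_Bprod_mult_Bprod:
  "B \<sigma> ^ 2 * Bprod \<sigma> k * Bprod \<sigma> a =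
    (\<Sum>l\<le>Suc k. ((qvar * \<sigma>) ^ l * lin_coeff 0 (int (Suc k)) (int (Suc a)) l) *\<^sub>q Bprod \<sigma> (Suc k + a - l))"
proof (rule mult_Bprod_expansion)
  \<comment> \<open>B^2 is the factor of index 0, since [0] = 0. The base case thus has exactly two
    terms, l = 0 and l = 1.\<close>
  have "B \<sigma> ^ 2 * Bprod \<sigma> k = Bprod \<sigma> k * (B \<sigma> ^ 2 - (qvar * \<sigma> * qint (2 * 0) ^ 2) *\<^sub>q 1)"
    by (simp add: power2_eq_square) (metis B_Bprod_commute mult.assoc)
  also have "\<dots> = Bprod \<sigma> (Suc k) + (qvar * \<sigma> * qint (2 * int (Suc k)) ^ 2) *\<^sub>q Bprod \<sigma> k"
    unfolding Bprod_mult_factor by (simp add: power2_eq_square mult.assoc del: of_nat_Suc)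
  also have "\<dots> =
      (\<Sum>l\<le>Suc k. ((qvar * \<sigma>) ^ l * lin_coeff 0 (int (Suc k)) (int (Suc 0)) l) *\<^sub>q Bprod \<sigma> (Suc k - l))"
  proof -
    have "lin_coeff 0 (int (Suc k)) (int (Suc 0)) (Suc 0) = qint (2 * int (Suc k)) ^ 2"
      by (simp add: lin_coeff_def power2_eq_square qint_pos_nonzero add.commute)
    then show ?thesis
      unfolding sum.atMost_shift
      by (simp add: sum.lessThan_Suc_shift lin_coeff_eq_0 del: of_nat_Suc sum.lessThan_Suc)
  qed
  finally show "B \<sigma> ^ 2 * Bprod \<sigma> k =
      (\<Sum>l\<le>Suc k. ((qvar * \<sigma>) ^ l * lin_coeff 0 (int (Suc k)) (int (Suc 0)) l) *\<^sub>q Bprod \<sigma> (Suc k - l))" .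
next
  fix a l
  show "(qvar * \<sigma>) ^ Suc l * lin_coeff 0 (int (Suc k)) (int (Suc (Suc a))) (Suc l) =
      (qvar * \<sigma>) ^ Suc l * lin_coeff 0 (int (Suc k)) (int (Suc a)) (Suc l) +
      qvar * \<sigma> * qint (2 * (int (Suc k) - int l)) * qint (2 * (int (Suc k) + 2 * int a + 2 - int l)) *
      ((qvar * \<sigma>) ^ l * lin_coeff 0 (int (Suc k)) (int (Suc a)) l)"
    using lin_coeff_Suc_right[of 0 "int (Suc k)" "int (Suc a)" l] by (simp add: algebra_simps)
qed simp

section \<open>From coefficients of P(n) to coefficients of divided powers\<close>

text \<open>The denominator [n-2m+1] cancels against one member of each pair in
  \<open>qfact_split\<close>; the other member moves into the numerator. The next lemma exchanges
  their roles.\<close>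

lemma qfact_mult_prod_odd:
  assumes "2 * l \<le> n"
  shows "qfact n * (\<Prod>m=1..l. f m / (qint (int n - 2 * int m + 1) * g m)) =
    qfact (n - 2 * l) * (\<Prod>m=1..l. f m * qint (int n - 2 * int m + 2) / g m)"
proof -
  have "(\<Prod>m=1..l. qint (int n - 2 * int m + 2) * qint (int n - 2 * int m + 1)) *
      (\<Prod>m=1..l. f m / (qint (int n - 2 * int m + 1) * g m)) =
      (\<Prod>m=1..l. f m * qint (int n - 2 * int m + 2) / g m)"
    unfolding prod.distrib[symmetric]
    by (intro prod.cong refl) (use assms in \<open>simp add: qint_pos_nonzero\<close>)
  then show ?thesis
    by (simp add: qfact_split[OF assms] mult.assoc)
qed

lemma qfact_mult_prod_even:
  assumes "2 * l \<le> n"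
  shows "qfact n * (\<Prod>m=1..l. f m / (qint (int n - 2 * int m + 2) * g m)) =
    qfact (n - 2 * l) * (\<Prod>m=1..l. f m * qint (int n - 2 * int m + 1) / g m)"
proof -
  have "(\<Prod>m=1..l. qint (int n - 2 * int m + 2) * qint (int n - 2 * int m + 1)) *
      (\<Prod>m=1..l. f m / (qint (int n - 2 * int m + 2) * g m)) =
      (\<Prod>m=1..l. f m * qint (int n - 2 * int m + 1) / g m)"
    unfolding prod.distrib[symmetric]
    by (intro prod.cong refl) (use assms in \<open>simp add: qint_pos_nonzero\<close>)
  then show ?thesis
    by (simp add: qfact_split[OF assms] mult.assoc)
qed

text \<open>The product in the stated formulas. \<open>n\<close> is independent of \<open>k\<close>
  and \<open>a\<close> because the odd-odd formula, after shifting k, a and m by one, has n =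
  2k+2a+2, while the others have n = 2k+2a.\<close>

definition ratio_prod :: "int \<Rightarrow> int \<Rightarrow> int \<Rightarrow> nat \<Rightarrow> qfield" where
  "ratio_prod n k a l = (\<Prod>m=1..l. (qint (2*a - 2*int m + 2) * qint (2*k - 2*int m + 2)) /
     (qint (n - 2*int m + 1) * qint (2*int m)))"

text \<open>The surviving pair members [2(k+a+2-m)] supply the third factor of
  \<open>lin_coeff\<close> with e = 2.\<close>

lemma qfact_mult_ratio_prod_even:
  assumes "l \<le> k"
  shows "qfact (2 * k + 2 * a + 2) * ratio_prod (2 * int k + 2 * int a + 2) (int k) (int a) l =
    qfact (2 * (k + a - l) + 2) * lin_coeff 2 (int k) (int a) l"
proof -
  have "2 * k + 2 * a + 2 - 2 * l = 2 * (k + a - l) + 2"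
    using assms by simp
  moreover have "2 * l \<le> 2 * k + 2 * a + 2"
    using assms by simp
  note qfact_mult_prod_odd[OF this, of
      "\<lambda>m. qint (2 * int a - 2 * int m + 2) * qint (2 * int k - 2 * int m + 2)" "\<lambda>m. qint (2 * int m)"]
  ultimately show ?thesis
    by (simp add: ratio_prod_def lin_coeff_def algebra_simps)
qed

text \<open>Here the factorial has odd order, so the denominators cancel the upper member of each
  pair; the lower ones give e = 0.\<close>

lemma qfact_mult_ratio_prod_odd:
  assumes "l \<le> Suc k"
  shows "qfact (2 * Suc k + 2 * a + 1) *
      ratio_prod (2 * int (Suc k) + 2 * int (Suc a)) (int (Suc k)) (int (Suc a)) l =
    qfact (2 * (Suc k + a - l) + 1) * lin_coeff 0 (int (Suc k)) (int (Suc a)) l"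
proof -
  have "2 * Suc k + 2 * a + 1 - 2 * l = 2 * (Suc k + a - l) + 1"
    using assms by simp
  moreover have "2 * l \<le> 2 * Suc k + 2 * a + 1"
    using assms by simp
  note qfact_mult_prod_even[OF this, of
      "\<lambda>m. qint (2 * int (Suc a) - 2 * int m + 2) * qint (2 * int (Suc k) - 2 * int m + 2)"
      "\<lambda>m. qint (2 * int m)"]
  ultimately show ?thesis
    by (simp add: ratio_prod_def lin_coeff_def algebra_simps)
qed

lemma B2_mult_Bprod_Bprod_expansion:
  "B \<sigma> ^ 2 * (Bprod \<sigma> k * Bprod \<sigma> a) = qfact (2 * k + 2 * a + 2) *\<^sub>q
    (\<Sum>l\<le>k. (ratio_prod (2 * int k + 2 * int a + 2) (int k) (int a) l * (qvar * \<sigma>) ^ l) *\<^sub>q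
      idp0 \<sigma> (2 * (k + a - l) + 2))"
  unfolding Bprod_mult_Bprod sum_distrib_left U.scale_sum_right idp0_even
proof (intro sum.cong refl)
  fix l assume "l \<in> {..k}"
  then show "B \<sigma> ^ 2 * (((qvar * \<sigma>) ^ l * lin_coeff 2 (int k) (int a) l) *\<^sub>q Bprod \<sigma> (k + a - l)) =
      qfact (2 * k + 2 * a + 2) *\<^sub>q
      (ratio_prod (2 * int k + 2 * int a + 2) (int k) (int a) l * (qvar * \<sigma>) ^ l) *\<^sub>q
      inverse (qfact (2 * (k + a - l) + 2)) *\<^sub>q (B \<sigma> ^ 2 * Bprod \<sigma> (k + a - l))"
    unfolding scaleq_mult_right scaleq_scaleq mult.assoc[symmetric]
    by (subst qfact_mult_ratio_prod_even) (simp_all add: mult_ac)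
qed

text \<open>\<open>W\<close> will be B for mixed parities and B^2 for two even ones.\<close>

lemma mult_B2_Bprod_Bprod_expansion:
  "W * (B \<sigma> ^ 2 * Bprod \<sigma> k * Bprod \<sigma> a) = qfact (2 * Suc k + 2 * a + 1) *\<^sub>q
    (\<Sum>l\<le>Suc k. (ratio_prod (2 * int (Suc k) + 2 * int (Suc a)) (int (Suc k)) (int (Suc a)) l *
      (qvar * \<sigma>) ^ l) *\<^sub>q
      inverse (qfact (2 * (Suc k + a - l) + 1)) *\<^sub>q (W * Bprod \<sigma> (Suc k + a - l)))"
  unfolding B2_Bprod_mult_Bprod sum_distrib_left U.scale_sum_right
proof (intro sum.cong refl)
  fix l assume "l \<in> {..Suc k}"
  then show "W * (((qvar * \<sigma>) ^ l * lin_coeff 0 (int (Suc k)) (int (Suc a)) l) *\<^sub>q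
        Bprod \<sigma> (Suc k + a - l)) =
      qfact (2 * Suc k + 2 * a + 1) *\<^sub>q
      (ratio_prod (2 * int (Suc k) + 2 * int (Suc a)) (int (Suc k)) (int (Suc a)) l *
        (qvar * \<sigma>) ^ l) *\<^sub>q
      inverse (qfact (2 * (Suc k + a - l) + 1)) *\<^sub>q (W * Bprod \<sigma> (Suc k + a - l))"
    unfolding scaleq_mult_right scaleq_scaleq mult.assoc[symmetric]
    by (subst qfact_mult_ratio_prod_odd) (simp_all add: mult_ac)
qed

section \<open>The four products of divided powers, with indices starting at 0\<close>

lemma qbinom_scaleq:
  assumes "m + n = N"
  shows "(inverse (qfact m) * inverse (qfact n)) *\<^sub>q qfact N *\<^sub>q x = qbinom N m *\<^sub>q x"
proof -
  have "N - m = n" using assms by simp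
  then show ?thesis
    by (simp add: qbinom_def scaleq_scaleq field_simps)
qed

lemma B_left_commute: "Bprod \<sigma> n * (B \<sigma> * x) = B \<sigma> * (Bprod \<sigma> n * x)"
  by (metis B_Bprod_commute mult.assoc)

lemma idp0_odd_mult_odd:
  "idp0 \<sigma> (2 * k + 1) * idp0 \<sigma> (2 * a + 1) = qbinom (2 * k + 2 * a + 2) (2 * k + 1) *\<^sub>q
    (\<Sum>l\<le>k. (ratio_prod (2 * int k + 2 * int a + 2) (int k) (int a) l * (qvar * \<sigma>) ^ l) *\<^sub>q
      idp0 \<sigma> (2 * (k + a - l) + 2))"
proof -
  have "idp0 \<sigma> (2 * k + 1) * idp0 \<sigma> (2 * a + 1) =
      (inverse (qfact (2 * k + 1)) * inverse (qfact (2 * a + 1))) *\<^sub>q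
      (B \<sigma> ^ 2 * (Bprod \<sigma> k * Bprod \<sigma> a))"
    unfolding idp0_odd scaleq_mult_left scaleq_mult_right scaleq_scaleq
    \<comment> \<open>\<open>mult.commute\<close> cannot reorder factors in \<open>U\<close>, which
      is only a \<open>ring_1\<close>; it matches up the scalars.\<close>
    by (simp only: mult.assoc power2_eq_square B_left_commute, simp only: mult.commute)
  also have "\<dots> = qbinom (2 * k + 2 * a + 2) (2 * k + 1) *\<^sub>q
    (\<Sum>l\<le>k. (ratio_prod (2 * int k + 2 * int a + 2) (int k) (int a) l * (qvar * \<sigma>) ^ l) *\<^sub>q
      idp0 \<sigma> (2 * (k + a - l) + 2))"
    unfolding B2_mult_Bprod_Bprod_expansion by (rule qbinom_scaleq) simp
  finally show ?thesis .
qed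

lemma idp0_odd_mult_even:
  "idp0 \<sigma> (2 * k + 1) * idp0 \<sigma> (2 * a + 2) = qbinom (2 * Suc k + 2 * a + 1) (2 * k + 1) *\<^sub>q
    (\<Sum>l\<le>Suc k. (ratio_prod (2 * int (Suc k) + 2 * int (Suc a)) (int (Suc k)) (int (Suc a)) l *
      (qvar * \<sigma>) ^ l) *\<^sub>q idp0 \<sigma> (2 * (Suc k + a - l) + 1))"
proof -
  have "idp0 \<sigma> (2 * k + 1) * idp0 \<sigma> (2 * a + 2) =
      (inverse (qfact (2 * k + 1)) * inverse (qfact (2 * a + 2))) *\<^sub>q
      (B \<sigma> * (B \<sigma> ^ 2 * Bprod \<sigma> k * Bprod \<sigma> a))"
    unfolding idp0_odd idp0_even scaleq_mult_left scaleq_mult_right scaleq_scaleq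
    by (simp only: mult.assoc power2_eq_square B_left_commute, simp only: mult.commute)
  also have "\<dots> = qbinom (2 * Suc k + 2 * a + 1) (2 * k + 1) *\<^sub>q
    (\<Sum>l\<le>Suc k. (ratio_prod (2 * int (Suc k) + 2 * int (Suc a)) (int (Suc k)) (int (Suc a)) l *
      (qvar * \<sigma>) ^ l) *\<^sub>q idp0 \<sigma> (2 * (Suc k + a - l) + 1))"
    unfolding mult_B2_Bprod_Bprod_expansion idp0_odd by (rule qbinom_scaleq) simp
  finally show ?thesis .
qed

lemma idp0_even_mult_odd:
  "idp0 \<sigma> (2 * k + 2) * idp0 \<sigma> (2 * a + 1) = qbinom (2 * Suc k + 2 * a + 1) (2 * k + 2) *\<^sub>q
    (\<Sum>l\<le>Suc k. (ratio_prod (2 * int (Suc k) + 2 * int (Suc a)) (int (Suc k)) (int (Suc a)) l *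
      (qvar * \<sigma>) ^ l) *\<^sub>q idp0 \<sigma> (2 * (Suc k + a - l) + 1))"
proof -
  have "idp0 \<sigma> (2 * k + 2) * idp0 \<sigma> (2 * a + 1) =
      (inverse (qfact (2 * k + 2)) * inverse (qfact (2 * a + 1))) *\<^sub>q
      (B \<sigma> * (B \<sigma> ^ 2 * Bprod \<sigma> k * Bprod \<sigma> a))"
    unfolding idp0_odd idp0_even scaleq_mult_left scaleq_mult_right scaleq_scaleq
    by (simp only: mult.assoc power2_eq_square B_left_commute, simp only: mult.commute)
  also have "\<dots> = qbinom (2 * Suc k + 2 * a + 1) (2 * k + 2) *\<^sub>q
    (\<Sum>l\<le>Suc k. (ratio_prod (2 * int (Suc k) + 2 * int (Suc a)) (int (Suc k)) (int (Suc a)) l *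
      (qvar * \<sigma>) ^ l) *\<^sub>q idp0 \<sigma> (2 * (Suc k + a - l) + 1))"
    unfolding mult_B2_Bprod_Bprod_expansion idp0_odd by (rule qbinom_scaleq) simp
  finally show ?thesis .
qed

text \<open>B^4 P(k) P(a) is expanded into B^2 P(n) with the factorials [2n+1]! of the odd case.
  Passing to [2n+2]! in each term and in the prefactor produces the extra quotient of two quantum
  integers.\<close>

lemma idp0_even_mult_even:
  "idp0 \<sigma> (2 * k + 2) * idp0 \<sigma> (2 * a + 2) = qbinom (2 * Suc k + 2 * Suc a) (2 * k + 2) *\<^sub>q
    (\<Sum>l\<le>Suc k. (qint (int (2 * (Suc k + a - l) + 2)) / qint (int (2 * Suc k + 2 * Suc a)) *
      ratio_prod (2 * int (Suc k) + 2 * int (Suc a)) (int (Suc k)) (int (Suc a)) l *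
      (qvar * \<sigma>) ^ l) *\<^sub>q idp0 \<sigma> (2 * (Suc k + a - l) + 2))"
    (is "_ = _ *\<^sub>q ?S")
proof -
  let ?c = "\<lambda>l. ratio_prod (2 * int (Suc k) + 2 * int (Suc a)) (int (Suc k)) (int (Suc a)) l *
      (qvar * \<sigma>) ^ l"
  let ?N = "2 * Suc k + 2 * Suc a"
  have N: "qfact ?N = qfact (2 * Suc k + 2 * a + 1) * qint (int ?N)"
    using qfact_Suc[of "2 * Suc k + 2 * a + 1"] by simp
  have nz: "qint (int ?N) \<noteq> 0"
    by (rule qint_pos_nonzero) simp
  have "idp0 \<sigma> (2 * k + 2) * idp0 \<sigma> (2 * a + 2) =
      (inverse (qfact (2 * k + 2)) * inverse (qfact (2 * a + 2))) *\<^sub>q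
      (B \<sigma> ^ 2 * (B \<sigma> ^ 2 * Bprod \<sigma> k * Bprod \<sigma> a))"
    unfolding idp0_even scaleq_mult_left scaleq_mult_right scaleq_scaleq
    by (simp only: mult.assoc power2_eq_square B_left_commute, simp only: mult.commute)
  also have "B \<sigma> ^ 2 * (B \<sigma> ^ 2 * Bprod \<sigma> k * Bprod \<sigma> a) = qfact ?N *\<^sub>q ?S"
    unfolding mult_B2_Bprod_Bprod_expansion U.scale_sum_right
  proof (intro sum.cong refl)
    fix l
    let ?M = "2 * (Suc k + a - l) + 1"
    have "qfact (?M + 1) = qfact ?M * qint (int (?M + 1))"
      using qfact_Suc[of ?M] by simp
    moreover have "qint (int (?M + 1)) \<noteq> 0"
      by (rule qint_pos_nonzero) simp
    ultimately have "inverse (qfact ?M) = qint (int (?M + 1)) * inverse (qfact (?M + 1))"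
      by (simp only: inverse_mult_distrib) simp
    moreover have "?M + 1 = 2 * (Suc k + a - l) + 2"
      by simp
    ultimately have M: "inverse (qfact ?M) =
        qint (int (2 * (Suc k + a - l) + 2)) * inverse (qfact (2 * (Suc k + a - l) + 2))"
      by metis
    show "qfact (2 * Suc k + 2 * a + 1) *\<^sub>q ?c l *\<^sub>q inverse (qfact ?M) *\<^sub>q
        (B \<sigma> ^ 2 * Bprod \<sigma> (Suc k + a - l)) =
      qfact ?N *\<^sub>q (qint (int (2 * (Suc k + a - l) + 2)) / qint (int ?N) *
        ratio_prod (2 * int (Suc k) + 2 * int (Suc a)) (int (Suc k)) (int (Suc a)) l *
        (qvar * \<sigma>) ^ l) *\<^sub>q idp0 \<sigma> (2 * (Suc k + a - l) + 2)"
      unfolding idp0_even scaleq_scaleq M N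
      using nz by (intro arg_cong2[of _ _ _ _ scaleq] refl) (simp only: field_simps, simp)
  qed
  also have "(inverse (qfact (2 * k + 2)) * inverse (qfact (2 * a + 2))) *\<^sub>q \<dots> =
      qbinom ?N (2 * k + 2) *\<^sub>q ?S"
    by (rule qbinom_scaleq) simp
  finally show ?thesis .
qed

section \<open>Reindexing to the stated form\<close>

lemma sum_atMost_split_0:
  fixes f :: "nat \<Rightarrow> 'a::comm_monoid_add"
  shows "sum f {..n} = f 0 + sum f {1..n}"
  by (simp add: sum.atMost_shift sum.atLeast1_atMost_eq)

lemma ratio_prod_0 [simp]: "ratio_prod n k a 0 = 1"
  by (simp add: ratio_prod_def)

theorem theorem2p3:
  fixes \<sigma> :: qfield and k a :: nat
  assumes "\<sigma> \<noteq> 0" and "k \<ge> 1" and "a \<ge> 1"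
  shows
    "idp0 \<sigma> (2*k - 1) * idp0 \<sigma> (2*a - 1) =
       qbinom (2*k + 2*a - 2) (2*k - 1) *\<^sub>q
         (idp0 \<sigma> (2*k + 2*a - 2) +
          (\<Sum>l=2..k.
             ((\<Prod>m=2..l. (qint (2*int a - 2*int m + 2) * qint (2*int k - 2*int m + 2)) /
                         (qint (2*int k + 2*int a - 2*int m + 1) * qint (2*int m - 2)))
              * (qvar * \<sigma>) ^ (l - 1)) *\<^sub>q idp0 \<sigma> (2*k + 2*a - 2*l))) \<and>
     idp0 \<sigma> (2*k - 1) * idp0 \<sigma> (2*a) =
       qbinom (2*k + 2*a - 1) (2*k - 1) *\<^sub>q
         (idp0 \<sigma> (2*k + 2*a - 1) +
          (\<Sum>l=1..k.
             ((\<Prod>m=1..l. (qint (2*int a - 2*int m + 2) * qint (2*int k - 2*int m + 2)) /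
                         (qint (2*int k + 2*int a - 2*int m + 1) * qint (2*int m)))
              * (qvar * \<sigma>) ^ l) *\<^sub>q idp0 \<sigma> (2*k + 2*a - 2*l - 1))) \<and>
     idp0 \<sigma> (2*k) * idp0 \<sigma> (2*a - 1) =
       qbinom (2*k + 2*a - 1) (2*k) *\<^sub>q
         (idp0 \<sigma> (2*k + 2*a - 1) +
          (\<Sum>l=1..k.
             ((\<Prod>m=1..l. (qint (2*int a - 2*int m + 2) * qint (2*int k - 2*int m + 2)) /
                         (qint (2*int k + 2*int a - 2*int m + 1) * qint (2*int m)))
              * (qvar * \<sigma>) ^ l) *\<^sub>q idp0 \<sigma> (2*k + 2*a - 2*l - 1))) \<and>
     idp0 \<sigma> (2*k) * idp0 \<sigma> (2*a) =
       qbinom (2*k + 2*a) (2*k) *\<^sub>q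
         (idp0 \<sigma> (2*k + 2*a) +
          (\<Sum>l=1..k.
             (qint (2*int k + 2*int a - 2*int l) / qint (2*int k + 2*int a) *
              (\<Prod>m=1..l. (qint (2*int a - 2*int m + 2) * qint (2*int k - 2*int m + 2)) /
                         (qint (2*int k + 2*int a - 2*int m + 1) * qint (2*int m)))
              * (qvar * \<sigma>) ^ l) *\<^sub>q idp0 \<sigma> (2*k + 2*a - 2*l)))"
proof -
  obtain k' a' where k: "k = Suc k'" and a: "a = Suc a'"
    using assms by (metis One_nat_def Suc_le_D)
  have odd: "2 * k - 1 = 2 * k' + 1" "2 * a - 1 = 2 * a' + 1"
    and even: "2 * k = 2 * k' + 2" "2 * a = 2 * a' + 2"
    by (simp_all add: k a)
  let ?s = "qvar * \<sigma>"
  \<comment> \<open>Both l and m are lowered by one, so that sum and product start at 1 and the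
    upper limit k becomes k'.\<close>
  have oo: "(\<Sum>l=2..k. ((\<Prod>m=2..l. (qint (2*int a - 2*int m + 2) * qint (2*int k - 2*int m + 2)) /
        (qint (2*int k + 2*int a - 2*int m + 1) * qint (2*int m - 2))) * ?s ^ (l - 1)) *\<^sub>q
        idp0 \<sigma> (2*k + 2*a - 2*l)) =
      (\<Sum>l=1..k'. (ratio_prod (2 * int k' + 2 * int a' + 2) (int k') (int a') l * ?s ^ l) *\<^sub>q
        idp0 \<sigma> (2 * (k' + a' - l) + 2))"
  proof -
    have "(\<Prod>m=2..Suc l. (qint (2*int a - 2*int m + 2) * qint (2*int k - 2*int m + 2)) /
        (qint (2*int k + 2*int a - 2*int m + 1) * qint (2*int m - 2))) =
        ratio_prod (2 * int k' + 2 * int a' + 2) (int k') (int a') l" for l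
      unfolding ratio_prod_def numeral_2_eq_2 prod.shift_bounds_cl_Suc_ivl
      by (intro prod.cong) (simp_all add: k a algebra_simps)
    moreover have "2*k + 2*a - 2 * Suc l = 2 * (k' + a' - l) + 2" if "l \<in> {1..k'}" for l
      using that by (auto simp: k a)
    moreover have "(\<Sum>l=2..k. f l) = (\<Sum>l=1..k'. f (Suc l))" for f :: "nat \<Rightarrow> U"
      by (simp only: k numeral_2_eq_2 One_nat_def sum.shift_bounds_cl_Suc_ivl)
    ultimately show ?thesis
      by (simp only: diff_Suc_1 cong: sum.cong)
  qed
  have prod_eq: "(\<Prod>m=1..l. (qint (2*int a - 2*int m + 2) * qint (2*int k - 2*int m + 2)) /
      (qint (2*int k + 2*int a - 2*int m + 1) * qint (2*int m))) =
      ratio_prod (2 * int (Suc k') + 2 * int (Suc a')) (int (Suc k')) (int (Suc a')) l" for l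
    by (simp only: ratio_prod_def k a)
  \<comment> \<open>The restriction on l makes the truncated subtractions exact, so these are
    applied under the sums by congruence.\<close>
  have index_odd: "2*k + 2*a - 2*l - 1 = 2 * (Suc k' + a' - l) + 1"
    and index_even: "2*k + 2*a - 2*l = 2 * (Suc k' + a' - l) + 2"
    and qint_even: "qint (2*int k + 2*int a - 2*int l) = qint (int (2 * (Suc k' + a' - l) + 2))"
    if "l \<in> {1..k}" for l
  proof -
    show "2*k + 2*a - 2*l - 1 = 2 * (Suc k' + a' - l) + 1"
      and "2*k + 2*a - 2*l = 2 * (Suc k' + a' - l) + 2"
      using that by (auto simp: k a)
    have "2*int k + 2*int a - 2*int l = int (2 * (Suc k' + a' - l) + 2)"
      using that by (auto simp: k a of_nat_diff)
    then show "qint (2*int k + 2*int a - 2*int l) = qint (int (2 * (Suc k' + a' - l) + 2))"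
      by (rule arg_cong)
  qed
  have odd_sum: "idp0 \<sigma> (2*k + 2*a - 1) + (\<Sum>l=1..k.
      ((\<Prod>m=1..l. (qint (2*int a - 2*int m + 2) * qint (2*int k - 2*int m + 2)) /
        (qint (2*int k + 2*int a - 2*int m + 1) * qint (2*int m))) * ?s ^ l) *\<^sub>q
        idp0 \<sigma> (2*k + 2*a - 2*l - 1)) =
      (\<Sum>l\<le>Suc k'. (ratio_prod (2 * int (Suc k') + 2 * int (Suc a')) (int (Suc k')) (int (Suc a')) l *
        ?s ^ l) *\<^sub>q idp0 \<sigma> (2 * (Suc k' + a' - l) + 1))"
  proof -
    have "2*k + 2*a - 1 = 2 * (Suc k' + a' - 0) + 1"
      by (simp add: k a)
    then show ?thesis
      unfolding sum_atMost_split_0 prod_eq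
      by (simp only: ratio_prod_0 power_0 mult_1_left scaleq_one k[symmetric] index_odd cong: sum.cong)
  qed
  have even_sum: "idp0 \<sigma> (2*k + 2*a) + (\<Sum>l=1..k.
      (qint (2*int k + 2*int a - 2*int l) / qint (2*int k + 2*int a) *
      (\<Prod>m=1..l. (qint (2*int a - 2*int m + 2) * qint (2*int k - 2*int m + 2)) /
        (qint (2*int k + 2*int a - 2*int m + 1) * qint (2*int m))) * ?s ^ l) *\<^sub>q
        idp0 \<sigma> (2*k + 2*a - 2*l)) =
      (\<Sum>l\<le>Suc k'. (qint (int (2 * (Suc k' + a' - l) + 2)) / qint (int (2 * Suc k' + 2 * Suc a')) *
        ratio_prod (2 * int (Suc k') + 2 * int (Suc a')) (int (Suc k')) (int (Suc a')) l *
        ?s ^ l) *\<^sub>q idp0 \<sigma> (2 * (Suc k' + a' - l) + 2))"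
  proof -
    \<comment> \<open>The leading term is the summand l = 0, where the quotient is [2k+2a]/[2k+2a] =
      1.\<close>
    have nz: "qint (int (2 * k + 2 * Suc a')) \<noteq> 0"
      by (rule qint_pos_nonzero) simp
    have index: "2 * (k + a' - 0) + 2 = 2 * k + 2 * Suc a'" "2*k + 2*a = 2 * k + 2 * Suc a'"
      "2*int k + 2*int a = int (2 * k + 2 * Suc a')"
      by (simp_all add: a)
    show ?thesis
      unfolding sum_atMost_split_0 prod_eq
      by (simp only: k[symmetric] index_even qint_even cong: sum.cong)
        (simp only: index nz divide_self ratio_prod_0 power_0 mult_1_left scaleq_one
          simp_thms)
  qed
  show ?thesis
  proof (intro conjI, goal_cases)
    case 1
    have *: "2*k + 2*a - 2 = 2 * k' + 2 * a' + 2"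
      by (simp add: k a)
    show ?case
      unfolding oo unfolding odd idp0_odd_mult_odd sum_atMost_split_0 *
      by (simp add: scaleq_one algebra_simps)
  next
    case 2
    have *: "2*k + 2*a - 1 = 2 * Suc k' + 2 * a' + 1"
      by (simp add: k a)
    show ?case
      unfolding odd_sum unfolding * odd unfolding even idp0_odd_mult_even ..
  next
    case 3
    have *: "2*k + 2*a - 1 = 2 * Suc k' + 2 * a' + 1"
      by (simp add: k a)
    show ?case
      unfolding odd_sum unfolding * odd unfolding even idp0_even_mult_odd ..
  next
    case 4
    have *: "2*k + 2*a = 2 * Suc k' + 2 * Suc a'"
      by (simp add: k a)
    show ?case
      unfolding even_sum unfolding * unfolding even idp0_even_mult_even ..
  qed
qed

end
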